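(* Let $\Sigma$ be a monoidal signature. The canonical trace of $\mathrm{Csp}_D(\mathbf{Hyp}_\Sigma)$ restricts to a trace on $\mathsf{PM}\,\mathrm{Csp}_D(\mathbf{Hyp}_\Sigma)$: for every partial monogamous cospan $x+m\xrightarrow{[f,h]}F\xleftarrow{[g,k]}x+n$, its canonical trace $\mathrm{Tr}^x$, a cospan $m\to F'\leftarrow n$, is again partial monogamous.
   Context: A monoidal signature $\Sigma$ is a set of generators each with an arity and coarity in $\mathbb{N}$. A hypergraph $F$ has a set $F_\star$ of vertices and sets $F_{k,l}$ of hyperedges with ordered source maps $s_i$ ($i<k$) and target maps $t_j$ ($j<l$) into $F_\star$; $\mathbf{Hyp}_\Sigma$ is the category of hypergraphs whose hyperedges in $F_{k,l}$ are labelled by generators of arity $k$ and coarity $l$, with label-, source- and target-preserving morphisms. The discrete hypergraph $n$ has $n$ vertices and no hyperedges. $\mathrm{Csp}_D(\mathbf{Hyp}_\Sigma)$ is the PROP whose morphisms $m\to n$ are isomorphism classes of cospans $m\to F\leftarrow n$ in $\mathbf{Hyp}_\Sigma$, with composition by pushout and tensor by disjoint union. It carries a Frobenius structure given by the discrete cospans merge $n+n\to n\leftarrow n$, unit $0\to n\leftarrow n$, copy $n\to n\leftarrow n+n$, counit $n\to n\leftarrow 0$; with $\mathrm{cup}_x=$ unit;copy and $\mathrm{cap}_x=$ merge;counit, the canonical trace of $h:x+m\to x+n$ is $\mathrm{Tr}^x(h)=(\mathrm{cup}_x\otimes\mathrm{id}_m);(\mathrm{id}_x\otimes h);(\mathrm{cap}_x\otimes\mathrm{id}_n)$.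 Concretely, for $x+m\xrightarrow{[f,h]}F\xleftarrow{[g,k]}x+n$ it is the cospan $m\to F'\leftarrow n$ with $F'$ the quotient of $F$ identifying $f(a)$ with $g(a)$ for all $a\in x$, and legs induced by $h$ and $k$. The degree of a vertex $v$ is $(\mathrm{in},\mathrm{out})$, $\mathrm{in}$ being the number of pairs $(e,j)$ with $v=t_j(e)$ and $\mathrm{out}$ the number of pairs $(e,i)$ with $v=s_i(e)$. A cospan $m\xrightarrow{f}F\xleftarrow{g}n$ is partial monogamous if $f,g$ are injective and each vertex has degree $(0,0)$ if it is in the images of both $f$ and $g$, $(0,1)$ if only in the image of $f$, $(1,0)$ if only in the image of $g$, and $(0,0)$ or $(1,1)$ otherwise. $\mathsf{PM}\,\mathrm{Csp}_D(\mathbf{Hyp}_\Sigma)$ is the sub-PROP of partial monogamous cospans. *)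

theory Defs
  imports "HOL-Library.Extended_Nat" "HOL-Library.Infinite_Typeclass"
begin

record 'g signature =
  gens :: "'g set"
  arity :: "'g \<Rightarrow> nat"
  coarity :: "'g \<Rightarrow> nat"

text \<open>
  All hyperedges form one set; the part \<open>F\<^bsub>k,l\<^esub>\<close> consists of those \<open>e\<close> with
  \<open>length (src F e) = k\<close> and \<open>length (tgt F e) = l\<close>, and \<open>s\<^sub>i(e)\<close>, \<open>t\<^sub>j(e)\<close> are
  \<open>src F e ! i\<close>, \<open>tgt F e ! j\<close>.
\<close>

record ('v, 'e, 'g) hypergraph =
  verts :: "'v set"
  edges :: "'e set"
  src :: "'e \<Rightarrow> 'v list"
  tgt :: "'e \<Rightarrow> 'v list"
  lab :: "'e \<Rightarrow> 'g"

definition hypergraph :: "'g signature \<Rightarrow> ('v, 'e, 'g) hypergraph \<Rightarrow> bool" where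
  "hypergraph \<Sigma> F \<longleftrightarrow> (\<forall>e\<in>edges F.
     set (src F e) \<subseteq> verts F \<and> set (tgt F e) \<subseteq> verts F \<and> lab F e \<in> gens \<Sigma> \<and>
     length (src F e) = arity \<Sigma> (lab F e) \<and> length (tgt F e) = coarity \<Sigma> (lab F e))"

definition hyp_hom ::
  "('v, 'e, 'g) hypergraph \<Rightarrow> ('w, 'f, 'g) hypergraph \<Rightarrow> ('v \<Rightarrow> 'w) \<Rightarrow> ('e \<Rightarrow> 'f) \<Rightarrow> bool" where
  "hyp_hom F G \<phi> \<psi> \<longleftrightarrow> \<phi> ` verts F \<subseteq> verts G \<and> \<psi> ` edges F \<subseteq> edges G \<and>
     (\<forall>e\<in>edges F. src G (\<psi> e) = map \<phi> (src F e) \<and> tgt G (\<psi> e) = map \<phi> (tgt F e) \<and>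
        lab G (\<psi> e) = lab F e)"

definition hyp_iso ::
  "('v, 'e, 'g) hypergraph \<Rightarrow> ('w, 'f, 'g) hypergraph \<Rightarrow> ('v \<Rightarrow> 'w) \<Rightarrow> ('e \<Rightarrow> 'f) \<Rightarrow> bool" where
  "hyp_iso F G \<phi> \<psi> \<longleftrightarrow> hyp_hom F G \<phi> \<psi> \<and>
     bij_betw \<phi> (verts F) (verts G) \<and> bij_betw \<psi> (edges F) (edges G)"

definition discrete :: "nat \<Rightarrow> (nat, 'e, 'g) hypergraph" where
  "discrete n = \<lparr>verts = {..<n}, edges = {}, src = (\<lambda>_. []), tgt = (\<lambda>_. []), lab = (\<lambda>_. undefined)\<rparr>"

definition disj_union ::
  "('v, 'e, 'g) hypergraph \<Rightarrow> ('w, 'f, 'g) hypergraph \<Rightarrow> ('v + 'w, 'e + 'f, 'g) hypergraph" where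
  "disj_union F G = \<lparr>verts = verts F <+> verts G, edges = edges F <+> edges G,
     src = case_sum (\<lambda>e. map Inl (src F e)) (\<lambda>e. map Inr (src G e)),
     tgt = case_sum (\<lambda>e. map Inl (tgt F e)) (\<lambda>e. map Inr (tgt G e)),
     lab = case_sum (lab F) (lab G)\<rparr>"

text \<open>The vertices of \<open>glue F r\<close> are the classes of the equivalence relation generated by \<open>r\<close>.\<close>

definition glue_class :: "('v \<times> 'v) set \<Rightarrow> 'v \<Rightarrow> 'v set" where
  "glue_class r v = (r \<union> r\<inverse>)\<^sup>* `` {v}"

definition glue :: "('v, 'e, 'g) hypergraph \<Rightarrow> ('v \<times> 'v) set \<Rightarrow> ('v set, 'e, 'g) hypergraph" where
  "glue F r = \<lparr>verts = glue_class r ` verts F, edges = edges F,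
     src = (\<lambda>e. map (glue_class r) (src F e)), tgt = (\<lambda>e. map (glue_class r) (tgt F e)),
     lab = lab F\<rparr>"


text \<open>
  A morphism from the discrete hypergraph \<open>n\<close> to \<open>F\<close> is an arbitrary map from \<open>{..<n}\<close> to the
  vertices of \<open>F\<close>. It is represented by its list of values, of length \<open>n\<close>. Hence copairing is
  list concatenation, and an injective leg is a distinct list.
\<close>

record ('v, 'e, 'g) cospan =
  apex :: "('v, 'e, 'g) hypergraph"
  left_leg :: "'v list"
  right_leg :: "'v list"

definition cospan :: "'g signature \<Rightarrow> nat \<Rightarrow> nat \<Rightarrow> ('v, 'e, 'g) cospan \<Rightarrow> bool" where
  "cospan \<Sigma> m n C \<longleftrightarrow> hypergraph \<Sigma> (apex C) \<and>
     length (left_leg C) = m \<and> set (left_leg C) \<subseteq> verts (apex C) \<and>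
     length (right_leg C) = n \<and> set (right_leg C) \<subseteq> verts (apex C)"

lemma hyp_hom_discrete_iff_list:
  "hyp_hom (discrete n) F \<phi> \<psi> \<longleftrightarrow> set (map \<phi> [0..<n]) \<subseteq> verts F"
  by (auto simp: hyp_hom_def discrete_def)

definition cospan_iso :: "('v, 'e, 'g) cospan \<Rightarrow> ('w, 'f, 'g) cospan \<Rightarrow> bool" where
  "cospan_iso C D \<longleftrightarrow> (\<exists>\<phi> \<psi>. hyp_iso (apex C) (apex D) \<phi> \<psi> \<and>
     left_leg D = map \<phi> (left_leg C) \<and> right_leg D = map \<phi> (right_leg C))"

definition pushout_rel :: "'v list \<Rightarrow> 'w list \<Rightarrow> (('v + 'w) \<times> ('v + 'w)) set" where
  "pushout_rel bs cs = set (zip (map Inl bs) (map Inr cs))"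

definition pushout_cospan ::
  "('v, 'e, 'g) cospan \<Rightarrow> ('w, 'f, 'g) cospan \<Rightarrow> (('v + 'w) set, 'e + 'f, 'g) cospan" where
  "pushout_cospan C D = (let r = pushout_rel (right_leg C) (left_leg D) in
     \<lparr>apex = glue (disj_union (apex C) (apex D)) r,
      left_leg = map (glue_class r \<circ> Inl) (left_leg C),
      right_leg = map (glue_class r \<circ> Inr) (right_leg D)\<rparr>)"

definition tensor_cospan ::
  "('v, 'e, 'g) cospan \<Rightarrow> ('w, 'f, 'g) cospan \<Rightarrow> ('v + 'w, 'e + 'f, 'g) cospan" where
  "tensor_cospan C D =
     \<lparr>apex = disj_union (apex C) (apex D),
      left_leg = map Inl (left_leg C) @ map Inr (left_leg D),
      right_leg = map Inl (right_leg C) @ map Inr (right_leg D)\<rparr>"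

definition id_cospan :: "nat \<Rightarrow> (nat, 'e, 'g) cospan" where
  "id_cospan n = \<lparr>apex = discrete n, left_leg = [0..<n], right_leg = [0..<n]\<rparr>"

definition merge_cospan :: "nat \<Rightarrow> (nat, 'e, 'g) cospan" where
  "merge_cospan n = \<lparr>apex = discrete n, left_leg = [0..<n] @ [0..<n], right_leg = [0..<n]\<rparr>"

definition unit_cospan :: "nat \<Rightarrow> (nat, 'e, 'g) cospan" where
  "unit_cospan n = \<lparr>apex = discrete n, left_leg = [], right_leg = [0..<n]\<rparr>"

definition copy_cospan :: "nat \<Rightarrow> (nat, 'e, 'g) cospan" where
  "copy_cospan n = \<lparr>apex = discrete n, left_leg = [0..<n], right_leg = [0..<n] @ [0..<n]\<rparr>"

definition counit_cospan :: "nat \<Rightarrow> (nat, 'e, 'g) cospan" where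
  "counit_cospan n = \<lparr>apex = discrete n, left_leg = [0..<n], right_leg = []\<rparr>"

text \<open>
  The vertex and edge types \<open>'v\<close>, \<open>'e\<close> of the members of an isomorphism class serve as a fixed
  universe. They are infinite, so that discrete hypergraphs, disjoint unions and gluings of
  hypergraphs in the universe again have isomorphic copies in it. Legs determine the domain and
  codomain of a cospan, so these need not be recorded in the class.
\<close>

definition csp_class ::
  "'g signature \<Rightarrow> ('w, 'f, 'g) cospan \<Rightarrow> ('v::infinite, 'e::infinite, 'g) cospan set" where
  "csp_class \<Sigma> C = {D. hypergraph \<Sigma> (apex D) \<and> cospan_iso C D}"

definition Csp :: "'g signature \<Rightarrow> nat \<Rightarrow> nat \<Rightarrow> ('v::infinite, 'e::infinite, 'g) cospan set set" where
  "Csp \<Sigma> m n = {csp_class \<Sigma> C | C :: ('v, 'e, 'g) cospan. cospan \<Sigma> m n C}"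

text \<open>As usual for quotients, an operation on classes is the union over all representatives.\<close>

definition csp_comp ::
  "'g signature \<Rightarrow> ('v::infinite, 'e::infinite, 'g) cospan set \<Rightarrow> ('v, 'e, 'g) cospan set
    \<Rightarrow> ('v, 'e, 'g) cospan set" where
  "csp_comp \<Sigma> A B = (\<Union>C\<in>A. \<Union>D\<in>B. csp_class \<Sigma> (pushout_cospan C D))"

definition csp_tensor ::
  "'g signature \<Rightarrow> ('v::infinite, 'e::infinite, 'g) cospan set \<Rightarrow> ('v, 'e, 'g) cospan set
    \<Rightarrow> ('v, 'e, 'g) cospan set" where
  "csp_tensor \<Sigma> A B = (\<Union>C\<in>A. \<Union>D\<in>B. csp_class \<Sigma> (tensor_cospan C D))"

definition csp_id :: "'g signature \<Rightarrow> nat \<Rightarrow> ('v::infinite, 'e::infinite, 'g) cospan set" where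
  "csp_id \<Sigma> n = csp_class \<Sigma> (id_cospan n :: (nat, 'e, 'g) cospan)"

definition csp_merge :: "'g signature \<Rightarrow> nat \<Rightarrow> ('v::infinite, 'e::infinite, 'g) cospan set" where
  "csp_merge \<Sigma> n = csp_class \<Sigma> (merge_cospan n :: (nat, 'e, 'g) cospan)"

definition csp_unit :: "'g signature \<Rightarrow> nat \<Rightarrow> ('v::infinite, 'e::infinite, 'g) cospan set" where
  "csp_unit \<Sigma> n = csp_class \<Sigma> (unit_cospan n :: (nat, 'e, 'g) cospan)"

definition csp_copy :: "'g signature \<Rightarrow> nat \<Rightarrow> ('v::infinite, 'e::infinite, 'g) cospan set" where
  "csp_copy \<Sigma> n = csp_class \<Sigma> (copy_cospan n :: (nat, 'e, 'g) cospan)"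

definition csp_counit :: "'g signature \<Rightarrow> nat \<Rightarrow> ('v::infinite, 'e::infinite, 'g) cospan set" where
  "csp_counit \<Sigma> n = csp_class \<Sigma> (counit_cospan n :: (nat, 'e, 'g) cospan)"

definition csp_cup :: "'g signature \<Rightarrow> nat \<Rightarrow> ('v::infinite, 'e::infinite, 'g) cospan set" where
  "csp_cup \<Sigma> x = csp_comp \<Sigma> (csp_unit \<Sigma> x) (csp_copy \<Sigma> x)"

definition csp_cap :: "'g signature \<Rightarrow> nat \<Rightarrow> ('v::infinite, 'e::infinite, 'g) cospan set" where
  "csp_cap \<Sigma> x = csp_comp \<Sigma> (csp_merge \<Sigma> x) (csp_counit \<Sigma> x)"

text \<open>For \<open>T\<close> in \<open>Csp \<Sigma> (x + m) (x + n)\<close>, the canonical trace lies in \<open>Csp \<Sigma> m n\<close>.\<close>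

definition canonical_trace ::
  "'g signature \<Rightarrow> nat \<Rightarrow> nat \<Rightarrow> nat \<Rightarrow> ('v::infinite, 'e::infinite, 'g) cospan set
    \<Rightarrow> ('v, 'e, 'g) cospan set" where
  "canonical_trace \<Sigma> x m n T =
     csp_comp \<Sigma>
       (csp_comp \<Sigma>
         (csp_tensor \<Sigma> (csp_cup \<Sigma> x) (csp_id \<Sigma> m))
         (csp_tensor \<Sigma> (csp_id \<Sigma> x) T))
       (csp_tensor \<Sigma> (csp_cap \<Sigma> x) (csp_id \<Sigma> n))"


text \<open>
  Hypergraphs may be infinite, so degrees are counted in \<^typ>\<open>enat\<close>: \<^const>\<open>card\<close> would give
  an infinite degree the value \<open>0\<close>.
\<close>

definition ecard :: "'a set \<Rightarrow> enat" where
  "ecard A = (if finite A then enat (card A) else \<infinity>)"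

definition in_degree :: "('v, 'e, 'g) hypergraph \<Rightarrow> 'v \<Rightarrow> enat" where
  "in_degree F v = ecard {(e, j). e \<in> edges F \<and> j < length (tgt F e) \<and> v = tgt F e ! j}"

definition out_degree :: "('v, 'e, 'g) hypergraph \<Rightarrow> 'v \<Rightarrow> enat" where
  "out_degree F v = ecard {(e, i). e \<in> edges F \<and> i < length (src F e) \<and> v = src F e ! i}"

definition degree :: "('v, 'e, 'g) hypergraph \<Rightarrow> 'v \<Rightarrow> enat \<times> enat" where
  "degree F v = (in_degree F v, out_degree F v)"

definition partial_monogamous :: "('v, 'e, 'g) cospan \<Rightarrow> bool" where
  "partial_monogamous C \<longleftrightarrow> distinct (left_leg C) \<and> distinct (right_leg C) \<and>
     (\<forall>v\<in>verts (apex C). degree (apex C) v \<in>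
        (if v \<in> set (left_leg C) \<and> v \<in> set (right_leg C) then {(0, 0)}
         else if v \<in> set (left_leg C) then {(0, 1)}
         else if v \<in> set (right_leg C) then {(1, 0)}
         else {(0, 0), (1, 1)}))"

definition PM_Csp ::
  "'g signature \<Rightarrow> nat \<Rightarrow> nat \<Rightarrow> ('v::infinite, 'e::infinite, 'g) cospan set set" where
  "PM_Csp \<Sigma> m n =
     {csp_class \<Sigma> C | C :: ('v, 'e, 'g) cospan. cospan \<Sigma> m n C \<and> partial_monogamous C}"


text \<open>The apex of \<^const>\<open>pushout_cospan\<close> is a pushout in the category of hypergraphs.\<close>

lemma glue_class_eq:
  assumes "(a, b) \<in> r"
  shows "glue_class r a = glue_class r b"
proof -
  have s: "sym ((r \<union> r\<inverse>)\<^sup>*)" by (intro sym_rtrancl) (auto simp: sym_def)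
  have ab: "(a, b) \<in> (r \<union> r\<inverse>)\<^sup>*" using assms by blast
  then have ba: "(b, a) \<in> (r \<union> r\<inverse>)\<^sup>*" using s by (meson symD)
  show ?thesis
    unfolding glue_class_def using ab ba by (auto intro: rtrancl_trans)
qed

lemma glue_class_lift:
  assumes "\<And>a b. (a, b) \<in> r \<Longrightarrow> f a = f b" and "w \<in> glue_class r v"
  shows "f w = f v"
proof -
  have "(v, w) \<in> (r \<union> r\<inverse>)\<^sup>*" using assms(2) by (simp add: glue_class_def)
  then show ?thesis by induction (auto dest: assms(1))
qed

lemma pushout_universal:
  fixes F :: "('v, 'e, 'g) hypergraph" and G :: "('w, 'f, 'g) hypergraph"
    and H :: "('u, 'h, 'g) hypergraph"
  assumes F: "hypergraph \<Sigma> F" and G: "hypergraph \<Sigma> G"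
    and bs: "length bs = n" "set bs \<subseteq> verts F" and cs: "length cs = n" "set cs \<subseteq> verts G"
  defines "r \<equiv> pushout_rel bs cs"
  defines "P \<equiv> glue (disj_union F G) r"
  shows "hypergraph \<Sigma> P"
    and "hyp_hom F P (glue_class r \<circ> Inl) Inl" and "hyp_hom G P (glue_class r \<circ> Inr) Inr"
    and "map (glue_class r \<circ> Inl) bs = map (glue_class r \<circ> Inr) cs"
    and "hyp_hom F H p p' \<Longrightarrow> hyp_hom G H q q' \<Longrightarrow> map p bs = map q cs \<Longrightarrow>
      \<exists>u u'. hyp_hom P H u u' \<and>
        (\<forall>v\<in>verts F. u (glue_class r (Inl v)) = p v) \<and> (\<forall>e\<in>edges F. u' (Inl e) = p' e) \<and>
        (\<forall>v\<in>verts G. u (glue_class r (Inr v)) = q v) \<and> (\<forall>e\<in>edges G. u' (Inr e) = q' e)"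
    and "(\<forall>v\<in>verts F. u (glue_class r (Inl v)) = w (glue_class r (Inl v))) \<Longrightarrow>
      (\<forall>v\<in>verts G. u (glue_class r (Inr v)) = w (glue_class r (Inr v))) \<Longrightarrow>
      (\<forall>v\<in>verts P. u v = w v)"
proof -
  show "hypergraph \<Sigma> P"
    using F G unfolding P_def hypergraph_def glue_def disj_union_def by fastforce
  show "hyp_hom F P (glue_class r \<circ> Inl) Inl" "hyp_hom G P (glue_class r \<circ> Inr) Inr"
    unfolding P_def hyp_hom_def glue_def disj_union_def by auto
  show "map (glue_class r \<circ> Inl) bs = map (glue_class r \<circ> Inr) cs"
  proof (rule nth_equalityI)
    fix i assume "i < length (map (glue_class r \<circ> Inl) bs)"
    then have i: "i < n" using bs by simp
    have "(Inl (bs ! i), Inr (cs ! i)) \<in> r"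
      using i bs cs unfolding r_def pushout_rel_def set_zip by (auto intro!: exI[of _ i])
    then show "map (glue_class r \<circ> Inl) bs ! i = map (glue_class r \<circ> Inr) cs ! i"
      using i bs cs by (simp add: glue_class_eq)
  qed (use bs cs in simp)
  show "\<forall>v\<in>verts P. u v = w v"
    if "\<forall>v\<in>verts F. u (glue_class r (Inl v)) = w (glue_class r (Inl v))"
      "\<forall>v\<in>verts G. u (glue_class r (Inr v)) = w (glue_class r (Inr v))"
    using that unfolding P_def glue_def disj_union_def by auto
  show "\<exists>u u'. hyp_hom P H u u' \<and>
        (\<forall>v\<in>verts F. u (glue_class r (Inl v)) = p v) \<and> (\<forall>e\<in>edges F. u' (Inl e) = p' e) \<and>
        (\<forall>v\<in>verts G. u (glue_class r (Inr v)) = q v) \<and> (\<forall>e\<in>edges G. u' (Inr e) = q' e)"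
    if hp: "hyp_hom F H p p'" and hq: "hyp_hom G H q q'" and pq: "map p bs = map q cs"
  proof -
    define u where "u = (\<lambda>X. case_sum p q (SOME y. y \<in> X))"
    have *: "case_sum p q a = case_sum p q b" if "(a, b) \<in> r" for a b
    proof -
      from that obtain i where "i < n" "a = Inl (bs ! i)" "b = Inr (cs ! i)"
        using bs cs unfolding r_def pushout_rel_def set_zip by auto
      moreover have "p (bs ! i) = q (cs ! i)"
        using pq bs cs \<open>i < n\<close> by (metis nth_map)
      ultimately show ?thesis by simp
    qed
    have u: "u (glue_class r y) = case_sum p q y" for y
    proof -
      have "y \<in> glue_class r y" by (simp add: glue_class_def)
      then have "(SOME z. z \<in> glue_class r y) \<in> glue_class r y" by (metis someI)
      then show ?thesis using glue_class_lift[of r "case_sum p q", OF *]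
        unfolding u_def by blast
    qed
    have "hyp_hom P H u (case_sum p' q')"
      using hp hq u unfolding P_def hyp_hom_def glue_def disj_union_def
      by (auto simp: image_subset_iff)
    then show ?thesis using u by (intro exI[of _ u] exI[of _ "case_sum p' q'"]) auto
  qed
qed

end

(*
  The canonical trace of a cospan is computed by two gluings: composing with the cup bends the
  first x left legs round to the right, and composing with the cap then identifies each f(i)
  with g(i). Since f and g are injective, the relation f(i) -> g(i) is a finite partial
  injection, so every class of glued vertices is a path or a cycle. A path vertex in the image
  of f has in-degree 0 and one in the image of g has out-degree 0, so a path inherits its
  in-degree and its membership in the left interface from its last vertex, and its out-degree
  and its membership in the right interface from its first one; a cycle is isolated.
*)

theory Submission
  imports Defs
begin

section \<open>Isomorphisms of cospans\<close>

text \<open>Operations on classes are unions over representatives in the fixed types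
  \<open>'v\<close> and \<open>'e\<close>, whereas cups, tensors, pushouts and gluings are built in
  \<open>nat\<close>, sum and set types. A union over an empty class is empty, so besides congruence
  under isomorphism every factor of a composite must be shown to have a copy in the universe. Each
  pushout is identified without analysing chains of its gluing relation: a retraction onto the
  vertices of the given cospan moves no vertex out of its gluing class, so vertices with the same
  image are glued. Chains matter only for the glued pairs f(i), g(i), and there finiteness is
  essential: under the successor relation on the naturals, which is injective, the one class has a
  start but no end, so starts and ends would not come together.\<close>

lemma hyp_iso_refl: "hyp_iso F F id id"
  by (simp add: hyp_iso_def hyp_hom_def)

lemma hyp_iso_trans:
  assumes "hyp_iso F G \<phi> \<psi>" "hyp_iso G H \<phi>' \<psi>'"
  shows "hyp_iso F H (\<phi>' \<circ> \<phi>) (\<psi>' \<circ> \<psi>)"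
proof -
  have "hyp_hom F H (\<phi>' \<circ> \<phi>) (\<psi>' \<circ> \<psi>)"
    using assms by (simp add: hyp_iso_def hyp_hom_def image_subset_iff)
  then show ?thesis
    using assms bij_betw_trans unfolding hyp_iso_def by metis
qed

text \<open>\<open>inv_into\<close> undoes \<open>\<phi>\<close> only on \<open>verts F\<close>, so
  the incidence lists must stay inside \<open>verts F\<close>; this is what well-formedness of
  \<open>F\<close> supplies.\<close>

lemma hyp_iso_sym:
  assumes F: "hypergraph \<Sigma> F" and iso: "hyp_iso F G \<phi> \<psi>"
  shows "hyp_iso G F (inv_into (verts F) \<phi>) (inv_into (edges F) \<psi>)"
proof -
  have v: "bij_betw \<phi> (verts F) (verts G)" and e: "bij_betw \<psi> (edges F) (edges G)"
    and hom: "hyp_hom F G \<phi> \<psi>"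
    using iso by (auto simp: hyp_iso_def)
  have inv: "map (inv_into (verts F) \<phi>) (map \<phi> vs) = vs" if "set vs \<subseteq> verts F" for vs
    using that bij_betw_inv_into_left[OF v] by (auto simp: map_idI subset_iff)
  have "hyp_hom G F (inv_into (verts F) \<phi>) (inv_into (edges F) \<psi>)"
    unfolding hyp_hom_def
  proof (intro conjI ballI)
    fix e' assume "e' \<in> edges G"
    then obtain a where a: "a \<in> edges F" "e' = \<psi> a" using e by (auto simp: bij_betw_def)
    then have "inv_into (edges F) \<psi> e' = a" using bij_betw_inv_into_left[OF e] by simp
    then show "src F (inv_into (edges F) \<psi> e') = map (inv_into (verts F) \<phi>) (src G e')"
      "tgt F (inv_into (edges F) \<psi> e') = map (inv_into (verts F) \<phi>) (tgt G e')"
      "lab F (inv_into (edges F) \<psi> e') = lab G e'"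
      using a hom F inv by (auto simp: hyp_hom_def hypergraph_def simp del: map_map)
  qed (use v e in \<open>auto simp: bij_betw_def inv_into_into\<close>)
  then show ?thesis
    using v e by (simp add: hyp_iso_def bij_betw_inv_into)
qed

lemma cospan_iso_refl: "cospan_iso C C"
  unfolding cospan_iso_def using hyp_iso_refl by fastforce

lemma cospan_iso_trans:
  assumes "cospan_iso C D" "cospan_iso D E"
  shows "cospan_iso C E"
  using assms unfolding cospan_iso_def by (fastforce intro: hyp_iso_trans)

lemma cospan_iso_sym:
  assumes C: "cospan \<Sigma> m n C" and iso: "cospan_iso C D"
  shows "cospan_iso D C"
proof -
  obtain \<phi> \<psi> where h: "hyp_iso (apex C) (apex D) \<phi> \<psi>"
    and legs: "left_leg D = map \<phi> (left_leg C)" "right_leg D = map \<phi> (right_leg C)"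
    using iso by (auto simp: cospan_iso_def)
  have inv: "map (inv_into (verts (apex C)) \<phi>) (map \<phi> vs) = vs" if "set vs \<subseteq> verts (apex C)" for vs
    using that h by (auto simp: map_idI subset_iff hyp_iso_def bij_betw_inv_into_left)
  have "hyp_iso (apex D) (apex C) (inv_into (verts (apex C)) \<phi>) (inv_into (edges (apex C)) \<psi>)"
    using C hyp_iso_sym[OF _ h, of \<Sigma>] by (simp add: cospan_def)
  moreover have "map (inv_into (verts (apex C)) \<phi>) (left_leg D) = left_leg C"
    "map (inv_into (verts (apex C)) \<phi>) (right_leg D) = right_leg C"
    unfolding legs using C by (simp_all only: inv cospan_def)
  ultimately show ?thesis
    unfolding cospan_iso_def by metis
qed

lemma cospan_iso_cospan:
  assumes "cospan \<Sigma> m n C" "cospan_iso C D" "hypergraph \<Sigma> (apex D)"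
  shows "cospan \<Sigma> m n D"
  using assms unfolding cospan_def cospan_iso_def hyp_iso_def hyp_hom_def by (auto simp: subset_iff)

lemma csp_class_eqI:
  assumes "cospan \<Sigma> m n C" "cospan_iso C D"
  shows "csp_class \<Sigma> C = (csp_class \<Sigma> D :: ('v::infinite, 'e::infinite, 'g) cospan set)"
proof -
  have "cospan_iso C E \<longleftrightarrow> cospan_iso D E" for E :: "('v, 'e, 'g) cospan"
    by (rule iffI) (erule cospan_iso_trans[OF cospan_iso_sym[OF assms]] cospan_iso_trans[OF assms(2)])+
  then show ?thesis by (simp add: csp_class_def)
qed

lemma csp_class_memD:
  assumes "cospan \<Sigma> m n C" "D \<in> csp_class \<Sigma> C"
  shows "cospan \<Sigma> m n D" "cospan_iso C D"
  using assms cospan_iso_cospan by (auto simp: csp_class_def)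

section \<open>Gluing\<close>

text \<open>A function constant on the generating pairs factors through the classes. Taking for
  \<open>f\<close> the class map of another relation compares two gluings.\<close>

lemma glue_class_eqD:
  assumes "\<And>a b. (a, b) \<in> r \<Longrightarrow> f a = f b" and "glue_class r v = glue_class r w"
  shows "f v = f w"
proof -
  have "v \<in> glue_class r v" by (simp add: glue_class_def)
  with assms show ?thesis using glue_class_lift[of r f] by metis
qed

lemma glue_class_eq_iff_mem: "glue_class r v = glue_class r w \<longleftrightarrow> w \<in> glue_class r v"
proof
  show "w \<in> glue_class r v" if "glue_class r v = glue_class r w"
    using that by (simp add: glue_class_def)
  \<comment> \<open>The class map is itself constant on generating pairs, so it can be lifted along
    its own relation.\<close>
  show "glue_class r v = glue_class r w" if "w \<in> glue_class r v"
    using glue_class_lift[of r "glue_class r", OF glue_class_eq that] by simp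
qed

lemma hypergraph_glue: "hypergraph \<Sigma> F \<Longrightarrow> hypergraph \<Sigma> (glue F r)"
  by (fastforce simp: hypergraph_def glue_def)

lemma hypergraph_disj_union:
  "hypergraph \<Sigma> F \<Longrightarrow> hypergraph \<Sigma> G \<Longrightarrow> hypergraph \<Sigma> (disj_union F G)"
  by (fastforce simp: hypergraph_def disj_union_def)

lemma hypergraph_discrete: "hypergraph \<Sigma> (discrete n)"
  by (simp add: hypergraph_def discrete_def)

lemma verts_disj_union [simp]: "verts (disj_union F G) = verts F <+> verts G"
  and edges_disj_union [simp]: "edges (disj_union F G) = edges F <+> edges G"
  by (simp_all add: disj_union_def)

lemma verts_glue [simp]: "verts (glue F r) = glue_class r ` verts F"
  and edges_glue [simp]: "edges (glue F r) = edges F"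
  by (simp_all add: glue_def)

text \<open>First isomorphism theorem for gluings: \<open>resp\<close> makes the induced map
  independent of the chosen representative, \<open>ker\<close> makes it injective. The equation for
  \<open>u\<close> holds at every \<open>v\<close>, not just at vertices, so legs can be mapped
  without side conditions.\<close>

lemma glue_isoI:
  assumes F: "hypergraph \<Sigma> F" and hom: "hyp_hom F G \<phi> \<psi>"
    and surj: "verts G \<subseteq> \<phi> ` verts F" and bij: "bij_betw \<psi> (edges F) (edges G)"
    and resp: "\<And>a b. (a, b) \<in> r \<Longrightarrow> \<phi> a = \<phi> b"
    and ker: "\<And>v w. v \<in> verts F \<Longrightarrow> w \<in> verts F \<Longrightarrow> \<phi> v = \<phi> w \<Longrightarrow> glue_class r v = glue_class r w"
  shows "\<exists>u. hyp_iso (glue F r) G u \<psi> \<and> (\<forall>v. u (glue_class r v) = \<phi> v)"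
proof (intro exI conjI allI)
  let ?u = "\<lambda>X. \<phi> (SOME y. y \<in> X)"
  show u: "?u (glue_class r v) = \<phi> v" for v
  proof -
    have "v \<in> glue_class r v" by (simp add: glue_class_def)
    then have "(SOME y. y \<in> glue_class r v) \<in> glue_class r v" by (metis someI)
    then show ?thesis using glue_class_lift[of r \<phi>, OF resp] by blast
  qed
  have "inj_on ?u (verts (glue F r))"
    unfolding inj_on_def verts_glue ball_simps(9) u using ker by blast
  moreover have "?u ` verts (glue F r) = verts G"
    using surj hom by (simp add: image_image u hyp_hom_def subset_antisym)
  ultimately have "bij_betw ?u (verts (glue F r)) (verts G)"
    by (simp add: bij_betw_def)
  then show "hyp_iso (glue F r) G ?u \<psi>"
    using hom bij by (simp add: hyp_iso_def hyp_hom_def glue_def image_subset_iff u comp_def)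
qed

lemma cospan_pushout:
  assumes "cospan \<Sigma> m k C" "cospan \<Sigma> k n D"
  shows "cospan \<Sigma> m n (pushout_cospan C D)"
proof -
  have "hypergraph \<Sigma> (apex (pushout_cospan C D))"
    using assms by (simp add: cospan_def pushout_cospan_def Let_def hypergraph_glue hypergraph_disj_union)
  then show ?thesis
    using assms by (auto simp: cospan_def pushout_cospan_def Let_def)
qed

lemma cospan_tensor:
  assumes "cospan \<Sigma> m n C" "cospan \<Sigma> m' n' D"
  shows "cospan \<Sigma> (m + m') (n + n') (tensor_cospan C D)"
proof -
  have "hypergraph \<Sigma> (apex (tensor_cospan C D))"
    using assms by (simp add: cospan_def tensor_cospan_def hypergraph_disj_union)
  then show ?thesis
    using assms by (auto simp: cospan_def tensor_cospan_def)
qed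

text \<open>Recognises a candidate \<open>E\<close> as the composite from a cocone \<open>p\<close>,
  \<open>q\<close>. The inner interface has two size variables \<open>k\<close> and
  \<open>k'\<close>, so that a sum bracketed in two ways fits as it stands.\<close>

lemma pushout_cospan_isoI:
  assumes C: "cospan \<Sigma> m k C" and D: "cospan \<Sigma> k' n D"
    and hom: "hyp_hom (disj_union (apex C) (apex D)) (apex E) (case_sum p q) \<psi>"
    and surj: "verts (apex E) \<subseteq> p ` verts (apex C) \<union> q ` verts (apex D)"
    and bij: "bij_betw \<psi> (edges (apex C) <+> edges (apex D)) (edges (apex E))"
    and resp: "\<And>a b. (a, b) \<in> pushout_rel (right_leg C) (left_leg D) \<Longrightarrow> case_sum p q a = case_sum p q b"
    and ker: "\<And>v w. v \<in> verts (apex C) <+> verts (apex D) \<Longrightarrow> w \<in> verts (apex C) <+> verts (apex D) \<Longrightarrow>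
      case_sum p q v = case_sum p q w \<Longrightarrow>
      glue_class (pushout_rel (right_leg C) (left_leg D)) v = glue_class (pushout_rel (right_leg C) (left_leg D)) w"
    and legs: "left_leg E = map p (left_leg C)" "right_leg E = map q (right_leg D)"
  shows "cospan_iso (pushout_cospan C D) E"
proof -
  let ?F = "disj_union (apex C) (apex D)" and ?r = "pushout_rel (right_leg C) (left_leg D)"
  have F: "hypergraph \<Sigma> ?F"
    using C D hypergraph_disj_union by (auto simp: cospan_def)
  have "\<exists>u. hyp_iso (glue ?F ?r) (apex E) u \<psi> \<and> (\<forall>v. u (glue_class ?r v) = case_sum p q v)"
  proof (rule glue_isoI[OF F hom])
    show "verts (apex E) \<subseteq> case_sum p q ` verts ?F"
      using surj by (simp add: Plus_def image_Un image_image)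
    show "bij_betw \<psi> (edges ?F) (edges (apex E))"
      using bij by simp
    show "glue_class ?r v = glue_class ?r w"
      if "v \<in> verts ?F" "w \<in> verts ?F" "case_sum p q v = case_sum p q w" for v w
      using that by (intro ker) simp_all
  qed (rule resp)
  then obtain u where "hyp_iso (glue ?F ?r) (apex E) u \<psi>" "\<And>v. u (glue_class ?r v) = case_sum p q v"
    by blast
  then show ?thesis
    unfolding cospan_iso_def pushout_cospan_def Let_def using legs
    by (intro exI[of _ u] exI[of _ \<psi>]) simp
qed

lemma bij_betw_map_sum:
  assumes "bij_betw f A A'" "bij_betw g B B'"
  shows "bij_betw (map_sum f g) (A <+> B) (A' <+> B')"
proof -
  have "inj_on (map_sum f g) (A <+> B)"
    using assms by (auto simp: bij_betw_def intro!: inj_onI dest: inj_onD)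
  moreover have "map_sum f g ` (A <+> B) = f ` A <+> g ` B"
    by (simp add: Plus_def image_Un image_image)
  ultimately show ?thesis
    using assms by (simp add: bij_betw_def)
qed

lemma disj_union_iso:
  assumes "hyp_iso F F' \<phi> \<psi>" "hyp_iso G G' \<phi>' \<psi>'"
  shows "hyp_iso (disj_union F G) (disj_union F' G') (map_sum \<phi> \<phi>') (map_sum \<psi> \<psi>')"
proof -
  have "hyp_hom (disj_union F G) (disj_union F' G') (map_sum \<phi> \<phi>') (map_sum \<psi> \<psi>')"
    using assms by (auto simp: hyp_iso_def hyp_hom_def disj_union_def)
  with assms show ?thesis
    by (simp add: hyp_iso_def bij_betw_map_sum disj_union_def)
qed

lemma tensor_cospan_cong:
  assumes "cospan_iso C C'" "cospan_iso D D'"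
  shows "cospan_iso (tensor_cospan C D) (tensor_cospan C' D')"
proof -
  obtain \<phi> \<psi> \<phi>' \<psi>' where
    "hyp_iso (apex C) (apex C') \<phi> \<psi>" "hyp_iso (apex D) (apex D') \<phi>' \<psi>'"
    "left_leg C' = map \<phi> (left_leg C)" "right_leg C' = map \<phi> (right_leg C)"
    "left_leg D' = map \<phi>' (left_leg D)" "right_leg D' = map \<phi>' (right_leg D)"
    using assms by (auto simp: cospan_iso_def)
  then show ?thesis
    unfolding cospan_iso_def tensor_cospan_def
    by (intro exI[of _ "map_sum \<phi> \<phi>'"] exI[of _ "map_sum \<psi> \<psi>'"]) (simp add: disj_union_iso)
qed

lemma pushout_rel_map:
  "pushout_rel (map \<phi> bs) (map \<phi>' cs) = map_prod (map_sum \<phi> \<phi>') (map_sum \<phi> \<phi>') ` pushout_rel bs cs"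
  by (auto simp: pushout_rel_def zip_map_map image_image split_def)

lemma glue_cong:
  assumes F: "hypergraph \<Sigma> F" and iso: "hyp_iso F G \<phi> \<psi>" and r: "r \<subseteq> verts F \<times> verts F"
  obtains u where "hyp_iso (glue F r) (glue G (map_prod \<phi> \<phi> ` r)) u \<psi>"
    "\<And>v. u (glue_class r v) = glue_class (map_prod \<phi> \<phi> ` r) (\<phi> v)"
proof -
  let ?r = "map_prod \<phi> \<phi> ` r" and ?\<phi>' = "inv_into (verts F) \<phi>"
  have v: "bij_betw \<phi> (verts F) (verts G)" and e: "bij_betw \<psi> (edges F) (edges G)"
    and hom: "hyp_hom F G \<phi> \<psi>"
    using iso by (auto simp: hyp_iso_def)
  have inv: "?\<phi>' (\<phi> a) = a" if "a \<in> verts F" for a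
    using that v by (simp add: bij_betw_inv_into_left)
  \<comment> \<open>To get injectivity, classes of \<open>?r\<close> are pulled back along the
    inverse of \<open>\<phi>\<close>; since \<open>r\<close> relates vertices only, the inverse
    returns the original pair.\<close>
  have "glue_class r (?\<phi>' a) = glue_class r (?\<phi>' b)" if "(a, b) \<in> ?r" for a b
    using that r inv by (auto simp: glue_class_eq)
  then have ker: "glue_class r a = glue_class r b"
    if "a \<in> verts F" "b \<in> verts F" "glue_class ?r (\<phi> a) = glue_class ?r (\<phi> b)" for a b
    using that inv glue_class_eqD[of ?r "glue_class r \<circ> ?\<phi>'" "\<phi> a" "\<phi> b"] by simp
  have "hyp_hom F (glue G ?r) (glue_class ?r \<circ> \<phi>) \<psi>"
    using hom by (auto simp: hyp_hom_def glue_def)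
  moreover have "verts (glue G ?r) \<subseteq> (glue_class ?r \<circ> \<phi>) ` verts F"
    using v by (simp add: glue_def bij_betw_def flip: image_image)
  moreover have "bij_betw \<psi> (edges F) (edges (glue G ?r))" using e by (simp add: glue_def)
  moreover have "(glue_class ?r \<circ> \<phi>) a = (glue_class ?r \<circ> \<phi>) b" if "(a, b) \<in> r" for a b
    using that by (simp add: glue_class_eq rev_image_eqI)
  ultimately have "\<exists>u. hyp_iso (glue F r) (glue G ?r) u \<psi> \<and>
      (\<forall>v. u (glue_class r v) = (glue_class ?r \<circ> \<phi>) v)"
    by (rule glue_isoI[OF F]) (assumption, rule ker, assumption+, simp)
  then show ?thesis using that by auto
qed

lemma pushout_cospan_cong:
  assumes C: "cospan \<Sigma> m k C" and D: "cospan \<Sigma> k' n D"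
    and "cospan_iso C C'" "cospan_iso D D'"
  shows "cospan_iso (pushout_cospan C D) (pushout_cospan C' D')"
proof -
  obtain \<phi> \<psi> \<phi>' \<psi>' where
    iso: "hyp_iso (apex C) (apex C') \<phi> \<psi>" "hyp_iso (apex D) (apex D') \<phi>' \<psi>'" and legs:
    "left_leg C' = map \<phi> (left_leg C)" "right_leg C' = map \<phi> (right_leg C)"
    "left_leg D' = map \<phi>' (left_leg D)" "right_leg D' = map \<phi>' (right_leg D)"
    using assms by (auto simp: cospan_iso_def)
  let ?F = "disj_union (apex C) (apex D)" and ?r = "pushout_rel (right_leg C) (left_leg D)"
  let ?G = "disj_union (apex C') (apex D')" and ?r' = "pushout_rel (right_leg C') (left_leg D')"
  have "hypergraph \<Sigma> ?F" using C D by (simp add: cospan_def hypergraph_disj_union)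
  moreover have "?r \<subseteq> verts ?F \<times> verts ?F"
    using C D by (auto simp: cospan_def pushout_rel_def disj_union_def zip_map_map dest: set_zip_leftD set_zip_rightD)
  ultimately obtain u where "hyp_iso (glue ?F ?r) (glue ?G ?r') u (map_sum \<psi> \<psi>')"
    "\<And>v. u (glue_class ?r v) = glue_class ?r' (map_sum \<phi> \<phi>' v)"
    using glue_cong[OF _ disj_union_iso[OF iso]] legs by (metis pushout_rel_map)
  then show ?thesis
    unfolding cospan_iso_def pushout_cospan_def Let_def using legs
    by (intro exI[of _ u] exI[of _ "map_sum \<psi> \<psi>'"]) simp
qed

section \<open>Composition and tensor of classes\<close>

text \<open>By congruence all pairs of representatives contribute the same class, so the union
  collapses; inhabitedness ensures that some pair contributes. \<open>C\<close> and \<open>D\<close>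
  may live outside the universe types, which lets discrete cospans over \<open>nat\<close> name the
  classes.\<close>

lemma csp_comp_class:
  fixes A B :: "('v::infinite, 'e::infinite, 'g) cospan set"
  assumes C: "cospan \<Sigma> m k C" and D: "cospan \<Sigma> k n D"
    and "A = csp_class \<Sigma> C" "A \<noteq> {}" "B = csp_class \<Sigma> D" "B \<noteq> {}"
  shows "csp_comp \<Sigma> A B = csp_class \<Sigma> (pushout_cospan C D)"
proof -
  have "csp_class \<Sigma> (pushout_cospan C D) = csp_class \<Sigma> (pushout_cospan C' D')"
    if "C' \<in> A" "D' \<in> B" for C' D'
    using that assms
    by (intro csp_class_eqI[OF cospan_pushout[OF C D]] pushout_cospan_cong[OF C D])
      (auto dest: csp_class_memD)
  then show ?thesis unfolding csp_comp_def using assms(4,6) by blast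
qed

lemma csp_tensor_class:
  fixes A B :: "('v::infinite, 'e::infinite, 'g) cospan set"
  assumes C: "cospan \<Sigma> m n C" and D: "cospan \<Sigma> m' n' D"
    and "A = csp_class \<Sigma> C" "A \<noteq> {}" "B = csp_class \<Sigma> D" "B \<noteq> {}"
  shows "csp_tensor \<Sigma> A B = csp_class \<Sigma> (tensor_cospan C D)"
proof -
  have "csp_class \<Sigma> (tensor_cospan C D) = csp_class \<Sigma> (tensor_cospan C' D')"
    if "C' \<in> A" "D' \<in> B" for C' D'
    using that assms
    by (intro csp_class_eqI[OF cospan_tensor[OF C D]] tensor_cospan_cong)
      (auto dest: csp_class_memD)
  then show ?thesis unfolding csp_tensor_def using assms(4,6) by blast
qed

text \<open>Transport of structure: the image of the apex under the two injections is an isomorphic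
  copy inside the universe.\<close>

lemma csp_class_nonempty:
  fixes f :: "'w \<Rightarrow> 'v::infinite" and g :: "'f \<Rightarrow> 'e::infinite"
  assumes C: "cospan \<Sigma> m n C"
    and f: "inj_on f (verts (apex C))" and g: "inj_on g (edges (apex C))"
  shows "(csp_class \<Sigma> C :: ('v, 'e, 'g) cospan set) \<noteq> {}"
proof -
  let ?F = "apex C" and ?g' = "inv_into (edges (apex C)) g"
  let ?G = "\<lparr>verts = f ` verts ?F, edges = g ` edges ?F, src = map f \<circ> src ?F \<circ> ?g',
    tgt = map f \<circ> tgt ?F \<circ> ?g', lab = lab ?F \<circ> ?g'\<rparr>"
  have "hyp_iso ?F ?G f g"
    using f g by (auto simp: hyp_iso_def hyp_hom_def bij_betw_def)
  moreover have "hypergraph \<Sigma> ?G"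
    using C g unfolding cospan_def hypergraph_def by (auto simp: image_subset_iff subset_iff)
  ultimately have "\<lparr>apex = ?G, left_leg = map f (left_leg C), right_leg = map f (right_leg C)\<rparr>
      \<in> csp_class \<Sigma> C"
    unfolding csp_class_def cospan_iso_def by (auto intro!: exI[of _ f] exI[of _ g])
  then show ?thesis by blast
qed

text \<open>An infinite cardinal absorbs doubling. This is where an infinite universe becomes closed
  under disjoint union.\<close>

lemma ex_inj_sum: "\<exists>f :: 'a::infinite + 'a \<Rightarrow> 'a. inj f"
proof -
  have "(card_of ((UNIV :: 'a set) <+> (UNIV :: 'a set)), card_of (UNIV :: 'a set)) \<in> ordIso"
    by (rule card_of_Plus_infinite1) (simp_all add: infinite_UNIV card_of_mono1)
  then obtain f :: "'a + 'a \<Rightarrow> 'a" where "bij_betw f (UNIV <+> UNIV) UNIV"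
    using card_of_ordIso by blast
  then show ?thesis by (auto simp: bij_betw_def)
qed

text \<open>Replacing both factors by representatives in the universe first puts the tensor into
  \<open>'v + 'v\<close> and \<open>'e + 'e\<close>, which embed back into \<open>'v\<close> and
  \<open>'e\<close>.\<close>

lemma csp_class_tensor_nonempty:
  assumes C: "cospan \<Sigma> m n C" and D: "cospan \<Sigma> m' n' D"
    and ne: "(csp_class \<Sigma> C :: ('v::infinite, 'e::infinite, 'g) cospan set) \<noteq> {}"
      "(csp_class \<Sigma> D :: ('v, 'e, 'g) cospan set) \<noteq> {}"
  shows "(csp_class \<Sigma> (tensor_cospan C D) :: ('v, 'e, 'g) cospan set) \<noteq> {}"
proof -
  obtain C' D' :: "('v, 'e, 'g) cospan" where C': "C' \<in> csp_class \<Sigma> C" and D': "D' \<in> csp_class \<Sigma> D"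
    using ne by blast
  obtain f :: "'v + 'v \<Rightarrow> 'v" and g :: "'e + 'e \<Rightarrow> 'e" where "inj f" "inj g"
    using ex_inj_sum by metis
  then have "(csp_class \<Sigma> (tensor_cospan C' D') :: ('v, 'e, 'g) cospan set) \<noteq> {}"
    by (intro csp_class_nonempty[OF cospan_tensor[OF csp_class_memD(1)[OF C C'] csp_class_memD(1)[OF D D']]])
      (auto intro: inj_on_subset)
  moreover have "csp_class \<Sigma> (tensor_cospan C D) = (csp_class \<Sigma> (tensor_cospan C' D') :: ('v, 'e, 'g) cospan set)"
    using csp_class_memD[OF C C'] csp_class_memD[OF D D']
    by (intro csp_class_eqI[OF cospan_tensor[OF C D]] tensor_cospan_cong)
  ultimately show ?thesis by simp
qed

lemma csp_class_edgeless_nonempty: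
  fixes C :: "(nat, 'f, 'g) cospan"
  assumes C: "cospan \<Sigma> m n C" and "edges (apex C) = {}"
  shows "(csp_class \<Sigma> C :: ('v::infinite, 'e::infinite, 'g) cospan set) \<noteq> {}"
proof -
  obtain f :: "nat \<Rightarrow> 'v" where "inj f"
    using infinite_countable_subset[OF infinite_UNIV] by blast
  then show ?thesis
    using assms(2) by (intro csp_class_nonempty[OF C, of f undefined])
      (auto simp: inj_on_def)
qed

section \<open>The canonical trace as a gluing\<close>

lemma hyp_hom_disj_union:
  "hyp_hom (disj_union F G) H (case_sum p q) (case_sum a b) \<longleftrightarrow> hyp_hom F H p a \<and> hyp_hom G H q b"
  by (simp add: hyp_hom_def disj_union_def case_sum_o_inj image_subset_iff Plus_def ball_Un) blast

lemma hyp_hom_discrete: "hyp_hom (discrete n) F \<phi> \<psi> \<longleftrightarrow> \<phi> ` {..<n} \<subseteq> verts F"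
  by (simp add: hyp_hom_def discrete_def)

lemma hyp_hom_id: "hyp_hom F F id id"
  by (simp add: hyp_hom_def)

lemma verts_discrete [simp]: "verts (discrete n) = {..<n}"
  and edges_discrete [simp]: "edges (discrete n) = {}"
  by (simp_all add: discrete_def)

text \<open>Discrete factors have no edges, so their half of the edge map is arbitrary; in the uses
  below \<open>undefined\<close> stands there.\<close>

lemma bij_betw_case_sum_empty:
  "bij_betw (case_sum a b) ({} <+> B) C \<longleftrightarrow> bij_betw b B C"
  "bij_betw (case_sum a b) (A <+> {}) C \<longleftrightarrow> bij_betw a A C"
  by (auto simp: bij_betw_def inj_on_def Plus_def image_image)

lemma Plus_empty: "{} <+> {} = {}"
  by auto

lemma set_zip_upt_left:
  assumes "length xs = n"
  shows "set (zip (map p [0..<n]) (map q xs)) = (\<lambda>i. (p i, q (xs ! i))) ` {..<n}"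
proof -
  have "zip (map p [0..<n]) (map q xs) = map (\<lambda>i. (p i, q (xs ! i))) [0..<n]"
    using assms by (intro nth_equalityI) simp_all
  then show ?thesis by (simp add: atLeast0LessThan)
qed

lemma set_zip_upt_right:
  assumes "length xs = n"
  shows "set (zip (map p xs) (map q [0..<n])) = (\<lambda>i. (p (xs ! i), q i)) ` {..<n}"
proof -
  have "zip (map p xs) (map q [0..<n]) = map (\<lambda>i. (p (xs ! i), q i)) [0..<n]"
    using assms by (intro nth_equalityI) simp_all
  then show ?thesis by (simp add: atLeast0LessThan)
qed

text \<open>The right leg of \<open>C\<close> is an identity, so each vertex \<open>i\<close> of its
  apex is glued exactly once, to \<open>left_leg D ! i\<close>. The pushout therefore absorbs the
  apex of \<open>C\<close> and only reindexes its left leg.\<close>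

lemma pushout_cospan_discrete_left:
  assumes C: "cospan \<Sigma> m k C" and "apex C = discrete k" "right_leg C = [0..<k]"
    and D: "cospan \<Sigma> k n D"
  shows "cospan_iso (pushout_cospan C D)
    \<lparr>apex = apex D, left_leg = map ((!) (left_leg D)) (left_leg C), right_leg = right_leg D\<rparr>"
proof (rule pushout_cospan_isoI[OF C D, where p = "(!) (left_leg D)" and q = id and \<psi> = "case_sum undefined id"])
  let ?L = "left_leg D" and ?r = "pushout_rel (right_leg C) (left_leg D)"
  have L: "length ?L = k" using D by (simp add: cospan_def)
  have r: "?r = (\<lambda>i. (Inl i, Inr (?L ! i))) ` {..<k}"
    using assms(3) L by (simp add: pushout_rel_def set_zip_upt_left)
  have glued: "glue_class ?r (Inl i) = glue_class ?r (Inr (?L ! i))" if "i < k" for i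
    using that by (intro glue_class_eq) (simp add: r)
  have retract: "glue_class ?r v = glue_class ?r (Inr (case_sum ((!) ?L) id v))"
    if "v \<in> verts (apex C) <+> verts (apex D)" for v
    using that assms(2) glued by (auto simp: discrete_def)
  show "glue_class ?r v = glue_class ?r w"
    if "v \<in> verts (apex C) <+> verts (apex D)" "w \<in> verts (apex C) <+> verts (apex D)"
      "case_sum ((!) ?L) id v = case_sum ((!) ?L) id w" for v w
    using that retract by metis
  show "case_sum ((!) ?L) id a = case_sum ((!) ?L) id b" if "(a, b) \<in> ?r" for a b
    using that by (auto simp: r)
  show "hyp_hom (disj_union (apex C) (apex D))
      (apex \<lparr>apex = apex D, left_leg = map ((!) ?L) (left_leg C), right_leg = right_leg D\<rparr>)
      (case_sum ((!) ?L) id) (case_sum undefined id)"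
    using assms(2) D by (auto simp: hyp_hom_disj_union hyp_hom_discrete hyp_hom_id cospan_def)
qed (use assms(2) in \<open>simp_all add: bij_betw_case_sum_empty\<close>)

definition cup_cospan :: "nat \<Rightarrow> (nat, 'e, 'g) cospan" where
  "cup_cospan n = \<lparr>apex = discrete n, left_leg = [], right_leg = [0..<n] @ [0..<n]\<rparr>"

definition cap_cospan :: "nat \<Rightarrow> (nat, 'e, 'g) cospan" where
  "cap_cospan n = \<lparr>apex = discrete n, left_leg = [0..<n] @ [0..<n], right_leg = []\<rparr>"

lemmas discrete_cospan_defs = id_cospan_def merge_cospan_def unit_cospan_def copy_cospan_def
  counit_cospan_def cup_cospan_def cap_cospan_def

lemma cospan_discrete [simp]:
  "cospan \<Sigma> n n (id_cospan n)"
  "cospan \<Sigma> (n + n) n (merge_cospan n)" "cospan \<Sigma> 0 n (unit_cospan n)"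
  "cospan \<Sigma> n (n + n) (copy_cospan n)" "cospan \<Sigma> n 0 (counit_cospan n)"
  "cospan \<Sigma> 0 (n + n) (cup_cospan n)" "cospan \<Sigma> (n + n) 0 (cap_cospan n)"
  by (auto simp: discrete_cospan_defs cospan_def hypergraph_discrete)

lemma csp_class_discrete_nonempty [simp]:
  fixes \<Sigma> :: "'g signature"
  shows "csp_class \<Sigma> (id_cospan n :: (nat, 'f, 'g) cospan) \<noteq> ({} :: ('v::infinite, 'e::infinite, 'g) cospan set)"
  "csp_class \<Sigma> (merge_cospan n :: (nat, 'f, 'g) cospan) \<noteq> ({} :: ('v, 'e, 'g) cospan set)"
  "csp_class \<Sigma> (unit_cospan n :: (nat, 'f, 'g) cospan) \<noteq> ({} :: ('v, 'e, 'g) cospan set)"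
  "csp_class \<Sigma> (copy_cospan n :: (nat, 'f, 'g) cospan) \<noteq> ({} :: ('v, 'e, 'g) cospan set)"
  "csp_class \<Sigma> (counit_cospan n :: (nat, 'f, 'g) cospan) \<noteq> ({} :: ('v, 'e, 'g) cospan set)"
  "csp_class \<Sigma> (cup_cospan n :: (nat, 'f, 'g) cospan) \<noteq> ({} :: ('v, 'e, 'g) cospan set)"
  "csp_class \<Sigma> (cap_cospan n :: (nat, 'f, 'g) cospan) \<noteq> ({} :: ('v, 'e, 'g) cospan set)"
  by (rule cospan_discrete[THEN csp_class_edgeless_nonempty],
      simp add: discrete_cospan_defs discrete_def)+

text \<open>Unit, and likewise merge in the case of the cap, ends in an identity leg, so the
  absorption of a discrete first factor computes both composites.\<close>

lemma csp_cup_eq: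
  "(csp_cup \<Sigma> x :: ('v::infinite, 'e::infinite, 'g) cospan set) = csp_class \<Sigma> (cup_cospan x :: (nat, 'e, 'g) cospan)"
proof -
  let ?U = "unit_cospan x :: (nat, 'e, 'g) cospan" and ?C = "copy_cospan x :: (nat, 'e, 'g) cospan"
  have "cospan_iso (pushout_cospan ?U ?C) \<lparr>apex = apex ?C,
      left_leg = map ((!) (left_leg ?C)) (left_leg ?U), right_leg = right_leg ?C\<rparr>"
    by (rule pushout_cospan_discrete_left[OF cospan_discrete(3) _ _ cospan_discrete(4)])
      (simp_all add: unit_cospan_def)
  then have "cospan_iso (pushout_cospan ?U ?C) (cup_cospan x :: (nat, 'e, 'g) cospan)"
    by (simp add: unit_cospan_def copy_cospan_def cup_cospan_def)
  then show ?thesis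
    unfolding csp_cup_def csp_unit_def csp_copy_def
    by (simp add: csp_comp_class[OF cospan_discrete(3,4) refl _ refl]
        csp_class_eqI[OF cospan_pushout[OF cospan_discrete(3,4)]])
qed

lemma csp_cap_eq:
  "(csp_cap \<Sigma> x :: ('v::infinite, 'e::infinite, 'g) cospan set) = csp_class \<Sigma> (cap_cospan x :: (nat, 'e, 'g) cospan)"
proof -
  let ?U = "merge_cospan x :: (nat, 'e, 'g) cospan" and ?C = "counit_cospan x :: (nat, 'e, 'g) cospan"
  have "cospan_iso (pushout_cospan ?U ?C) \<lparr>apex = apex ?C,
      left_leg = map ((!) (left_leg ?C)) (left_leg ?U), right_leg = right_leg ?C\<rparr>"
    by (rule pushout_cospan_discrete_left[OF cospan_discrete(2) _ _ cospan_discrete(5)])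
      (simp_all add: merge_cospan_def)
  moreover have "map ((!) [0..<x]) [0..<x] = [0..<x]" by (auto intro!: map_idI)
  ultimately have "cospan_iso (pushout_cospan ?U ?C) (cap_cospan x :: (nat, 'e, 'g) cospan)"
    by (simp add: merge_cospan_def counit_cospan_def cap_cospan_def)
  then show ?thesis
    unfolding csp_cap_def csp_merge_def csp_counit_def
    by (simp add: csp_comp_class[OF cospan_discrete(2,5) refl _ refl]
        csp_class_eqI[OF cospan_pushout[OF cospan_discrete(2,5)]])
qed

text \<open>Every vertex of the cup and of the identities is glued to a vertex of \<open>C\<close>,
  and no two vertices of \<open>C\<close> become identified. The apex survives unchanged, and the
  wires of \<open>id_cospan x\<close>, now equal to \<open>f\<close>, emerge as the first
  outputs.\<close>

lemma pushout_cup_iso: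
  fixes C :: "('v, 'e, 'g) cospan"
  assumes C: "cospan \<Sigma> (x + m) n C" and L: "left_leg C = f @ h" "length f = x" "length h = m"
  shows "cospan_iso
    (pushout_cospan (tensor_cospan (cup_cospan x :: (nat, 'e, 'g) cospan) (id_cospan m :: (nat, 'e, 'g) cospan))
      (tensor_cospan (id_cospan x :: (nat, 'e, 'g) cospan) C))
    \<lparr>apex = apex C, left_leg = h, right_leg = f @ right_leg C\<rparr>"
    (is "cospan_iso (pushout_cospan ?P ?Q) ?E")
proof -
  let ?p = "case_sum ((!) f) ((!) h)" and ?q = "case_sum ((!) f) id"
  define r where "r = pushout_rel (right_leg ?P) (left_leg ?Q)"
  have P: "cospan \<Sigma> m (x + x + m) ?P"
    using cospan_tensor[of \<Sigma> 0 "x + x" "cup_cospan x" m m "id_cospan m"] by simp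
  have Q: "cospan \<Sigma> (x + (x + m)) (x + n) ?Q"
    by (rule cospan_tensor[OF _ C]) simp
  \<comment> \<open>The three blocks: the first copy of the cup meets the identity wires, the second
    copy meets \<open>f\<close>, and the identity on \<open>m\<close> meets
    \<open>h\<close>.\<close>
  have r: "r = (\<lambda>i. (Inl (Inl i), Inr (Inl i))) ` {..<x} \<union>
      (\<lambda>i. (Inl (Inl i), Inr (Inr (f ! i)))) ` {..<x} \<union>
      (\<lambda>j. (Inl (Inr j), Inr (Inr (h ! j)))) ` {..<m}"
    using L by (simp add: r_def pushout_rel_def tensor_cospan_def cup_cospan_def id_cospan_def
        set_zip_upt_left comp_def Un_assoc)
  have glued: "glue_class r (Inl (Inl i)) = glue_class r (Inr (Inl i))"
    "glue_class r (Inl (Inl i)) = glue_class r (Inr (Inr (f ! i)))" if "i < x" for i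
    by (rule glue_class_eq; use that in \<open>simp add: r\<close>)+
  have glued': "glue_class r (Inl (Inr j)) = glue_class r (Inr (Inr (h ! j)))" if "j < m" for j
    by (rule glue_class_eq; use that in \<open>simp add: r\<close>)
  have retract: "glue_class r v = glue_class r (Inr (Inr (case_sum ?p ?q v)))"
    if "v \<in> verts (apex ?P) <+> verts (apex ?Q)" for v
    using that glued(2) glued(1)[symmetric] glued'
    by (auto simp: tensor_cospan_def cup_cospan_def id_cospan_def)
  show ?thesis
  proof (rule pushout_cospan_isoI[OF P Q, where p = ?p and q = ?q
        and \<psi> = "case_sum (case_sum undefined undefined) (case_sum undefined id)"], fold r_def)
    show "glue_class r v = glue_class r w"
      if "v \<in> verts (apex ?P) <+> verts (apex ?Q)" "w \<in> verts (apex ?P) <+> verts (apex ?Q)"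
        "case_sum ?p ?q v = case_sum ?p ?q w" for v w
      using that retract by metis
    show "case_sum ?p ?q a = case_sum ?p ?q b" if "(a, b) \<in> r" for a b
      using that unfolding r by auto
    show "hyp_hom (disj_union (apex ?P) (apex ?Q)) (apex ?E) (case_sum ?p ?q)
        (case_sum (case_sum undefined undefined) (case_sum undefined id))"
      using C L
      by (auto simp: hyp_hom_disj_union hyp_hom_discrete hyp_hom_id tensor_cospan_def
          cup_cospan_def id_cospan_def cospan_def)
    show "bij_betw (case_sum (case_sum undefined undefined) (case_sum undefined id))
        (edges (apex ?P) <+> edges (apex ?Q)) (edges (apex ?E))"
      by (simp add: bij_betw_case_sum_empty Plus_empty tensor_cospan_def cup_cospan_def id_cospan_def)
    show "verts (apex ?E) \<subseteq> ?p ` verts (apex ?P) \<union> ?q ` verts (apex ?Q)"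
      by (simp add: tensor_cospan_def Plus_def image_Un image_image le_supI2)
    show "left_leg ?E = map ?p (left_leg ?P)" "right_leg ?E = map ?q (right_leg ?Q)"
      using L map_nth[of f] map_nth[of h]
      by (auto simp: tensor_cospan_def cup_cospan_def id_cospan_def comp_def)
  qed
qed

text \<open>Vertex \<open>i\<close> of the cap is glued to both \<open>f ! i\<close> and
  \<open>g ! i\<close>, which is the only way in which vertices of \<open>C\<close> become
  identified. \<open>?\<rho>\<close> sends each vertex to a vertex of \<open>C\<close> in its class,
  so it remains to compare the classes of \<open>?s\<close> with those of \<open>r\<close>.\<close>

lemma pushout_cap_iso:
  fixes C :: "('v, 'e, 'g) cospan"
  assumes C: "cospan \<Sigma> m (x + x + n) C" and R: "right_leg C = f @ g @ k"
    "length f = x" "length g = x" "length k = n"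
  shows "cospan_iso
    (pushout_cospan C (tensor_cospan (cap_cospan x :: (nat, 'e, 'g) cospan) (id_cospan n :: (nat, 'e, 'g) cospan)))
    \<lparr>apex = glue (apex C) (set (zip f g)), left_leg = map (glue_class (set (zip f g))) (left_leg C),
      right_leg = map (glue_class (set (zip f g))) k\<rparr>"
    (is "cospan_iso (pushout_cospan C ?Q) ?E")
proof -
  let ?s = "set (zip f g)"
  let ?p = "glue_class ?s" and ?q = "case_sum (\<lambda>i. glue_class ?s (f ! i)) (\<lambda>j. glue_class ?s (k ! j))"
  let ?\<rho> = "case_sum id (case_sum ((!) f) ((!) k))"
  define r where "r = pushout_rel (right_leg C) (left_leg ?Q)"
  have Q: "cospan \<Sigma> (x + x + n) n ?Q"
    using cospan_tensor[of \<Sigma> "x + x" 0 "cap_cospan x" n n "id_cospan n"] by simp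
  have r: "r = (\<lambda>i. (Inl (f ! i), Inr (Inl i))) ` {..<x} \<union>
      (\<lambda>i. (Inl (g ! i), Inr (Inl i))) ` {..<x} \<union>
      (\<lambda>j. (Inl (k ! j), Inr (Inr j))) ` {..<n}"
    using R by (simp add: r_def pushout_rel_def tensor_cospan_def cap_cospan_def id_cospan_def
        set_zip_upt_right comp_def Un_assoc)
  have glued: "glue_class r (Inl (f ! i)) = glue_class r (Inr (Inl i))"
    "glue_class r (Inl (g ! i)) = glue_class r (Inr (Inl i))" if "i < x" for i
    by (rule glue_class_eq; use that in \<open>simp add: r\<close>)+
  have glued': "glue_class r (Inl (k ! j)) = glue_class r (Inr (Inr j))" if "j < n" for j
    by (rule glue_class_eq; use that in \<open>simp add: r\<close>)
  have s: "glue_class ?s (f ! i) = glue_class ?s (g ! i)" if "i < x" for i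
    using that R by (intro glue_class_eq) (auto simp: set_zip)
  have retract: "glue_class r v = glue_class r (Inl (?\<rho> v))"
    if "v \<in> verts (apex C) <+> verts (apex ?Q)" for v
    using that glued(1)[symmetric] glued'[symmetric]
    by (auto simp: tensor_cospan_def cap_cospan_def id_cospan_def)
  have \<rho>: "case_sum ?p ?q v = glue_class ?s (?\<rho> v)" for v
    by (auto split: sum.split)
  \<comment> \<open>A pair of \<open>?s\<close> is joined in \<open>r\<close> by two steps through a
    cap vertex, so the class map of \<open>r\<close> is constant on \<open>?s\<close>.\<close>
  have lift: "glue_class r (Inl a) = glue_class r (Inl b)"
    if ab: "glue_class ?s a = glue_class ?s b" for a b
  proof (rule glue_class_eqD[OF _ ab])
    fix a b assume "(a, b) \<in> ?s"
    then obtain i where "i < x" "a = f ! i" "b = g ! i" using R by (auto simp: set_zip)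
    then show "glue_class r (Inl a) = glue_class r (Inl b)" using glued by simp
  qed
  show ?thesis
  proof (rule pushout_cospan_isoI[OF C Q, where p = ?p and q = ?q
        and \<psi> = "case_sum id (case_sum undefined undefined)"], fold r_def)
    show "glue_class r v = glue_class r w"
      if "v \<in> verts (apex C) <+> verts (apex ?Q)" "w \<in> verts (apex C) <+> verts (apex ?Q)"
        "case_sum ?p ?q v = case_sum ?p ?q w" for v w
      using lift[OF that(3)[unfolded \<rho>]] retract[OF that(1)] retract[OF that(2)] by simp
    show "case_sum ?p ?q a = case_sum ?p ?q b" if "(a, b) \<in> r" for a b
      using that s unfolding r by auto
    have "hyp_hom (apex C) (glue (apex C) ?s) ?p id"
      by (simp add: hyp_hom_def glue_def)
    then show "hyp_hom (disj_union (apex C) (apex ?Q)) (apex ?E) (case_sum ?p ?q)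
        (case_sum id (case_sum undefined undefined))"
      using C R
      by (auto simp: hyp_hom_disj_union hyp_hom_discrete tensor_cospan_def
          cap_cospan_def id_cospan_def cospan_def subset_iff intro!: imageI)
    show "bij_betw (case_sum id (case_sum undefined undefined))
        (edges (apex C) <+> edges (apex ?Q)) (edges (apex ?E))"
      by (simp add: bij_betw_case_sum_empty Plus_empty tensor_cospan_def cap_cospan_def id_cospan_def)
    show "verts (apex ?E) \<subseteq> ?p ` verts (apex C) \<union> ?q ` verts (apex ?Q)"
      by simp
    have "map (\<lambda>j. glue_class ?s (k ! j)) [0..<n] = map (glue_class ?s) k"
      using R by (intro nth_equalityI) simp_all
    then show "left_leg ?E = map ?p (left_leg C)" "right_leg ?E = map ?q (right_leg ?Q)"
      by (simp_all add: tensor_cospan_def cap_cospan_def id_cospan_def comp_def)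
  qed
qed

text \<open>The concrete quotient description of the trace, on representatives. Its vertices are
  classes, so it leaves the universe type and must be copied back.\<close>

definition trace_cospan :: "nat \<Rightarrow> ('v, 'e, 'g) cospan \<Rightarrow> ('v set, 'e, 'g) cospan" where
  "trace_cospan x C = (let r = set (zip (take x (left_leg C)) (take x (right_leg C))) in
     \<lparr>apex = glue (apex C) r, left_leg = map (glue_class r) (drop x (left_leg C)),
      right_leg = map (glue_class r) (drop x (right_leg C))\<rparr>)"

lemma cospan_trace:
  assumes "cospan \<Sigma> (x + m) (x + n) C"
  shows "cospan \<Sigma> m n (trace_cospan x C)"
  using assms by (auto simp: cospan_def trace_cospan_def Let_def hypergraph_glue)
    (auto simp: glue_def dest!: in_set_dropD)

lemma canonical_trace_class:
  fixes C :: "('v::infinite, 'e::infinite, 'g) cospan"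
  assumes C: "cospan \<Sigma> (x + m) (x + n) C"
  shows "canonical_trace \<Sigma> x m n (csp_class \<Sigma> C :: ('v, 'e, 'g) cospan set) = csp_class \<Sigma> (trace_cospan x C)"
proof -
  define f h g k where "f = take x (left_leg C)" "h = drop x (left_leg C)"
    "g = take x (right_leg C)" "k = drop x (right_leg C)"
  then have legs: "left_leg C = f @ h" "right_leg C = g @ k"
    and len: "length f = x" "length h = m" "length g = x" "length k = n"
    using C by (auto simp: cospan_def)
  \<comment> \<open>The composite with the cup, that is, \<open>C\<close> with its first
    \<open>x\<close> left legs bent to the right.\<close>
  define E :: "('v, 'e, 'g) cospan" where
    "E = \<lparr>apex = apex C, left_leg = h, right_leg = f @ right_leg C\<rparr>"
  let ?id = "id_cospan :: nat \<Rightarrow> (nat, 'e, 'g) cospan"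
  let ?cup = "cup_cospan x :: (nat, 'e, 'g) cospan" and ?cap = "cap_cospan x :: (nat, 'e, 'g) cospan"
  let ?P = "tensor_cospan ?cup (?id m)" and ?Q = "tensor_cospan (?id x) C"
    and ?R = "tensor_cospan ?cap (?id n)"
  have E: "cospan \<Sigma> m (x + x + n) E"
    using C legs len by (auto simp: cospan_def E_def)
  have P: "cospan \<Sigma> m (x + x + m) ?P"
    using cospan_tensor[of \<Sigma> 0 "x + x" ?cup m m "?id m"] by simp
  have Q: "cospan \<Sigma> (x + x + m) (x + x + n) ?Q"
    using cospan_tensor[OF _ C, of x x "?id x"] by (simp add: add.assoc)
  have R: "cospan \<Sigma> (x + x + n) n ?R"
    using cospan_tensor[of \<Sigma> "x + x" 0 ?cap n n "?id n"] by simp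
  \<comment> \<open>A cospan whose types are those of the universe represents its own class; this
    covers \<open>C\<close> and \<open>E\<close>.\<close>
  have self: "csp_class \<Sigma> D \<noteq> ({} :: ('v, 'e, 'g) cospan set)" if "cospan \<Sigma> m' n' D" for m' n' and D :: "('v, 'e, 'g) cospan"
    using that by (auto simp: csp_class_def cospan_def intro: cospan_iso_refl)
  have ne: "csp_class \<Sigma> ?P \<noteq> ({} :: ('v, 'e, 'g) cospan set)" "csp_class \<Sigma> ?Q \<noteq> ({} :: ('v, 'e, 'g) cospan set)"
    "csp_class \<Sigma> ?R \<noteq> ({} :: ('v, 'e, 'g) cospan set)"
    using csp_class_tensor_nonempty[OF cospan_discrete(6) cospan_discrete(1)]
      csp_class_tensor_nonempty[OF cospan_discrete(1) C _ self[OF C]]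
      csp_class_tensor_nonempty[OF cospan_discrete(7) cospan_discrete(1)] by simp_all
  have "csp_tensor \<Sigma> (csp_cup \<Sigma> x) (csp_id \<Sigma> m) = (csp_class \<Sigma> ?P :: ('v, 'e, 'g) cospan set)"
    unfolding csp_cup_eq csp_id_def
    by (rule csp_tensor_class[OF cospan_discrete(6) cospan_discrete(1) refl _ refl]) simp_all
  moreover have "csp_tensor \<Sigma> (csp_id \<Sigma> x) (csp_class \<Sigma> C) = (csp_class \<Sigma> ?Q :: ('v, 'e, 'g) cospan set)"
    unfolding csp_id_def
    by (rule csp_tensor_class[OF cospan_discrete(1) C refl _ refl self[OF C]]) simp
  moreover have "csp_tensor \<Sigma> (csp_cap \<Sigma> x) (csp_id \<Sigma> n) = (csp_class \<Sigma> ?R :: ('v, 'e, 'g) cospan set)"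
    unfolding csp_cap_eq csp_id_def
    by (rule csp_tensor_class[OF cospan_discrete(7) cospan_discrete(1) refl _ refl]) simp_all
  moreover have "csp_comp \<Sigma> (csp_class \<Sigma> ?P) (csp_class \<Sigma> ?Q) = (csp_class \<Sigma> E :: ('v, 'e, 'g) cospan set)"
    unfolding csp_comp_class[OF P Q refl ne(1) refl ne(2)] E_def
    by (rule csp_class_eqI[OF cospan_pushout[OF P Q] pushout_cup_iso[OF C legs(1) len(1,2)]])
  moreover have "csp_comp \<Sigma> (csp_class \<Sigma> E) (csp_class \<Sigma> ?R) = (csp_class \<Sigma> (trace_cospan x C) :: ('v, 'e, 'g) cospan set)"
    unfolding csp_comp_class[OF E R refl self[OF E] refl ne(3)]
    using pushout_cap_iso[OF E, of f g k] legs len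
    by (intro csp_class_eqI[OF cospan_pushout[OF E R]]) (simp add: E_def trace_cospan_def Let_def)
  ultimately show ?thesis by (simp add: canonical_trace_def)
qed

section \<open>Gluing along a partial injection\<close>

lemma glue_class_converse: "glue_class (r\<inverse>) v = glue_class r v"
  by (simp add: glue_class_def Un_commute)

text \<open>Every undirected walk from an end can be straightened. A step that leads forward from
  \<open>y\<close> must, by single-valuedness, be the first step of the directed path from
  \<open>y\<close> to \<open>w\<close>; that path is not empty because \<open>w\<close> has no
  successor.\<close>

lemma rtrancl_to_end:
  assumes sv: "single_valued r" and w: "w \<notin> Domain r" and z: "z \<in> glue_class r w"
  shows "(z, w) \<in> r\<^sup>*"
proof -
  have "(w, z) \<in> (r \<union> r\<inverse>)\<^sup>*" using z by (simp add: glue_class_def)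
  then show ?thesis
  proof induction
    case (step y z)
    show ?case
    proof (cases "(z, y) \<in> r")
      case True
      then show ?thesis using step.IH by (rule converse_rtrancl_into_rtrancl)
    next
      case False
      then have yz: "(y, z) \<in> r" using step.hyps by blast
      show ?thesis
        using step.IH
      proof (cases rule: converse_rtranclE)
        case base
        then show ?thesis using yz w by blast
      next
        case (step y')
        then show ?thesis using yz sv by (metis single_valuedD)
      qed
    qed
  qed simp
qed

text \<open>One end would reach the other by a directed path, but no step leaves an end.\<close>

lemma glue_class_unique_end:
  assumes "single_valued r" "w \<in> glue_class r v" "w' \<in> glue_class r v" "w \<notin> Domain r" "w' \<notin> Domain r"
  shows "w = w'"
proof -
  have "w' \<in> glue_class r w"
    using assms(2,3) by (simp flip: glue_class_eq_iff_mem)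
  then have "(w', w) \<in> r\<^sup>*"
    using rtrancl_to_end assms by metis
  then show ?thesis
    using assms(5) by (cases rule: converse_rtranclE) auto
qed

lemma glue_class_step: "(a, b) \<in> r \<Longrightarrow> a \<in> glue_class r v \<longleftrightarrow> b \<in> glue_class r v"
  using glue_class_eq[of a b r] by (simp flip: glue_class_eq_iff_mem)

text \<open>A class without an end is a cycle: on it, the successor function is an injective
  endomap of a finite set.\<close>

lemma glue_class_cycle:
  assumes r: "finite r" "single_valued r" "single_valued (r\<inverse>)"
    and X: "glue_class r v \<subseteq> Domain r"
  shows "glue_class r v \<subseteq> Range r"
proof -
  let ?X = "glue_class r v"
  define f where "f a = (SOME b. (a, b) \<in> r)" for a
  have f: "(a, f a) \<in> r" if "a \<in> ?X" for a
    using that X unfolding f_def by (metis DomainE someI subsetD)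
  have "finite ?X"
    using X r(1) finite_Domain finite_subset by blast
  moreover have "f ` ?X \<subseteq> ?X"
    using f glue_class_step by fast
  moreover have "inj_on f ?X"
    using f r(3) by (metis converseI inj_onI single_valuedD)
  ultimately have "f ` ?X = ?X"
    by (rule endo_inj_surj)
  then show ?thesis using f by (metis RangeI image_iff subsetI)
qed

section \<open>Partial monogamy\<close>

lemma ecard_eq_0_iff: "ecard A = 0 \<longleftrightarrow> A = {}"
  by (auto simp: ecard_def zero_enat_def)

lemma ecard_image: "inj_on f A \<Longrightarrow> ecard (f ` A) = ecard A"
  by (simp add: ecard_def finite_image_iff card_image)

text \<open>If at most one vertex \<open>t\<close> of the class carries incidences, the incidence
  set of the class is literally that of \<open>t\<close>, and no cardinals need to be added. When
  all degrees in the class vanish, any \<open>t\<close> will do.\<close>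

lemma in_degree_glue:
  assumes "\<And>w. w \<in> glue_class r v \<Longrightarrow> w \<noteq> t \<Longrightarrow> in_degree F w = 0"
  shows "in_degree (glue F r) (glue_class r v) = (if t \<in> glue_class r v then in_degree F t else 0)"
proof -
  have "{(e, j). e \<in> edges F \<and> j < length (tgt F e) \<and> glue_class r v = glue_class r (tgt F e ! j)} =
      (if t \<in> glue_class r v then {(e, j). e \<in> edges F \<and> j < length (tgt F e) \<and> t = tgt F e ! j} else {})"
    using assms by (auto simp: in_degree_def ecard_eq_0_iff glue_class_eq_iff_mem)
  then show ?thesis
    by (simp add: in_degree_def glue_def ecard_eq_0_iff cong: conj_cong)
qed

lemma out_degree_glue:
  assumes "\<And>w. w \<in> glue_class r v \<Longrightarrow> w \<noteq> t \<Longrightarrow> out_degree F w = 0"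
  shows "out_degree (glue F r) (glue_class r v) = (if t \<in> glue_class r v then out_degree F t else 0)"
proof -
  have "{(e, j). e \<in> edges F \<and> j < length (src F e) \<and> glue_class r v = glue_class r (src F e ! j)} =
      (if t \<in> glue_class r v then {(e, j). e \<in> edges F \<and> j < length (src F e) \<and> t = src F e ! j} else {})"
    using assms by (auto simp: out_degree_def ecard_eq_0_iff glue_class_eq_iff_mem)
  then show ?thesis
    by (simp add: out_degree_def glue_def ecard_eq_0_iff cong: conj_cong)
qed

text \<open>Stated for an abstract incidence function \<open>t\<close>, so that it serves sources
  and targets alike; the bijection moves the edge and keeps the position.\<close>

lemma ecard_incidence_iso:
  assumes inj: "inj_on \<phi> V" "inj_on \<psi> E" and v: "v \<in> V"
    and hom: "\<And>e. e \<in> E \<Longrightarrow> t' (\<psi> e) = map \<phi> (t e)" and sub: "\<And>e. e \<in> E \<Longrightarrow> set (t e) \<subseteq> V"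
  shows "ecard {(e, j). e \<in> \<psi> ` E \<and> j < length (t' e) \<and> \<phi> v = t' e ! j} =
    ecard {(e, j). e \<in> E \<and> j < length (t e) \<and> v = t e ! j}" (is "ecard ?A = ecard ?B")
proof -
  have iff: "(\<psi> e, j) \<in> ?A \<longleftrightarrow> (e, j) \<in> ?B" if e: "e \<in> E" for e j
  proof -
    have "\<phi> v = \<phi> (t e ! j) \<longleftrightarrow> v = t e ! j" if "j < length (t e)"
      using inj_on_eq_iff[OF inj(1) v] nth_mem[OF that] sub[OF e] by blast
    then show ?thesis using e hom[OF e] by auto
  qed
  have "?A = map_prod \<psi> id ` ?B"
  proof (intro subset_antisym subsetI)
    fix p assume p: "p \<in> ?A"
    then obtain e j where e: "p = (\<psi> e, j)" "e \<in> E" by auto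
    with p have "(e, j) \<in> ?B" by (simp only: iff)
    then show "p \<in> map_prod \<psi> id ` ?B" by (rule rev_image_eqI) (simp add: e)
  next
    fix p assume "p \<in> map_prod \<psi> id ` ?B"
    then obtain e j where e: "p = (\<psi> e, j)" "(e, j) \<in> ?B" by auto
    then have "e \<in> E" by simp
    with e show "p \<in> ?A" by (simp only: iff)
  qed
  moreover have "inj_on (map_prod \<psi> id) ?B"
    using inj(2) by (auto simp: inj_on_def)
  ultimately show ?thesis by (simp add: ecard_image)
qed

lemma degree_iso:
  assumes F: "hypergraph \<Sigma> F" and iso: "hyp_iso F G \<phi> \<psi>" and v: "v \<in> verts F"
  shows "degree G (\<phi> v) = degree F v"
proof -
  have "inj_on \<phi> (verts F)" "inj_on \<psi> (edges F)" and onto: "edges G = \<psi> ` edges F"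
    and "\<And>e. e \<in> edges F \<Longrightarrow> src G (\<psi> e) = map \<phi> (src F e)"
    and "\<And>e. e \<in> edges F \<Longrightarrow> tgt G (\<psi> e) = map \<phi> (tgt F e)"
    using iso by (auto simp: hyp_iso_def hyp_hom_def bij_betw_def)
  with F v show ?thesis
    unfolding degree_def in_degree_def out_degree_def onto hypergraph_def
    by (intro arg_cong2[where f = Pair] ecard_incidence_iso) blast+
qed

text \<open>Allows partial monogamy to be checked on the explicit gluing and then moved to a copy in
  the universe.\<close>

lemma partial_monogamous_iso:
  assumes C: "cospan \<Sigma> m n C" and iso: "cospan_iso C D" and pm: "partial_monogamous C"
  shows "partial_monogamous D"
proof -
  obtain \<phi> \<psi> where h: "hyp_iso (apex C) (apex D) \<phi> \<psi>"
    and legs: "left_leg D = map \<phi> (left_leg C)" "right_leg D = map \<phi> (right_leg C)"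
    using iso by (auto simp: cospan_iso_def)
  have inj: "inj_on \<phi> (verts (apex C))" and onto: "verts (apex D) = \<phi> ` verts (apex C)"
    using h by (auto simp: hyp_iso_def bij_betw_def)
  have sub: "set (left_leg C) \<subseteq> verts (apex C)" "set (right_leg C) \<subseteq> verts (apex C)"
    and wf: "hypergraph \<Sigma> (apex C)"
    using C by (auto simp: cospan_def)
  have "distinct (left_leg D)" "distinct (right_leg D)"
    using pm sub inj by (auto simp: legs partial_monogamous_def distinct_map intro: inj_on_subset)
  moreover have "\<phi> v \<in> set (left_leg D) \<longleftrightarrow> v \<in> set (left_leg C)"
    "\<phi> v \<in> set (right_leg D) \<longleftrightarrow> v \<in> set (right_leg C)" if "v \<in> verts (apex C)" for v
    using that sub inj by (simp_all add: legs inj_on_image_mem_iff)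
  ultimately show ?thesis
    using pm degree_iso[OF wf h] unfolding partial_monogamous_def onto by (simp cong: if_cong)
qed

lemma partial_monogamous_trace:
  assumes C: "cospan \<Sigma> (x + m) (x + n) C" and pm: "partial_monogamous C"
  shows "partial_monogamous (trace_cospan x C)"
proof -
  define f h g k where "f = take x (left_leg C)" "h = drop x (left_leg C)"
    "g = take x (right_leg C)" "k = drop x (right_leg C)"
  then have legs: "left_leg C = f @ h" "right_leg C = g @ k"
    and len: "length f = x" "length g = x"
    using C by (auto simp: cospan_def)
  define r where "r = set (zip f g)"
  let ?cl = "glue_class r"
  have trace: "trace_cospan x C = \<lparr>apex = glue (apex C) r, left_leg = map ?cl h, right_leg = map ?cl k\<rparr>"
    using legs len by (simp add: trace_cospan_def r_def Let_def)
  have dist: "distinct f" "distinct h" "set f \<inter> set h = {}" "distinct g" "distinct k" "set g \<inter> set k = {}"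
    using pm by (auto simp: partial_monogamous_def legs)
  have sub: "set f \<subseteq> verts (apex C)" "set g \<subseteq> verts (apex C)"
    using C by (auto simp: cospan_def legs)
  \<comment> \<open>Steps lead from \<open>f ! i\<close> to \<open>g ! i\<close>: ends of paths are
    the vertices outside \<open>f\<close>, starts those outside \<open>g\<close>.\<close>
  have dom: "Domain r = set f" "Range r = set g"
    using len by (auto simp: r_def Domain_fst Range_snd simp flip: set_map)
  have r: "finite r" "single_valued r" "single_valued (r\<inverse>)"
    using dist len by (auto simp: r_def single_valued_def set_zip nth_eq_iff_index_eq)
  \<comment> \<open>A class without an end has no start, and the converse relation gives the other
    direction. Hence a class has both or neither.\<close>
  have cycle: "?cl v \<subseteq> set f \<longleftrightarrow> ?cl v \<subseteq> set g" for v
    using glue_class_cycle[OF r, of v] glue_class_cycle[of "r\<inverse>" v] r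
    by (auto simp: dom glue_class_converse)
  have uniq_end: "w = w'" if "w \<in> ?cl v" "w' \<in> ?cl v" "w \<notin> set f" "w' \<notin> set f" for v w w'
    using glue_class_unique_end[of r w v w'] r(2) that dom by simp
  have uniq_start: "w = w'" if "w \<in> ?cl v" "w' \<in> ?cl v" "w \<notin> set g" "w' \<notin> set g" for v w w'
    using glue_class_unique_end[of "r\<inverse>" w v w'] r(3) that dom by (simp add: glue_class_converse)
  have self: "v \<in> ?cl v" for v by (simp add: glue_class_def)
  \<comment> \<open>Vertices of \<open>h\<close> avoid \<open>f\<close>, hence are ends, and a class
    has at most one end. Dually, vertices of \<open>k\<close> are starts.\<close>
  have left: "distinct (map ?cl h)"
    using dist uniq_end self by (auto simp: distinct_map inj_on_def) (metis disjoint_iff)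
  have right: "distinct (map ?cl k)"
    using dist uniq_start self by (auto simp: distinct_map inj_on_def) (metis disjoint_iff)
  have deg: "(in_degree (apex C) v, out_degree (apex C) v) \<in>
      (if v \<in> set (f @ h) \<and> v \<in> set (g @ k) then {(0, 0)}
       else if v \<in> set (f @ h) then {(0, 1)}
       else if v \<in> set (g @ k) then {(1, 0)}
       else {(0, 0), (1, 1)})" if "v \<in> verts (apex C)" for v
    using that pm unfolding partial_monogamous_def legs degree_def by blast
  have in0: "in_degree (apex C) w = 0" if "w \<in> set f" for w
    using deg[of w] that sub by (auto split: if_splits)
  have out0: "out_degree (apex C) w = 0" if "w \<in> set g" for w
    using deg[of w] that sub by (auto split: if_splits)
  have mem_left: "?cl v \<in> set (map ?cl h) \<longleftrightarrow> ?cl v \<inter> set h \<noteq> {}"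
    and mem_right: "?cl v \<in> set (map ?cl k) \<longleftrightarrow> ?cl v \<inter> set k \<noteq> {}" for v
    by (auto simp: glue_class_eq_iff_mem)
  \<comment> \<open>Being a vertex is constant on \<open>r\<close>, because both components of each
    pair are vertices; so this predicate lifts to classes.\<close>
  have verts_cl: "?cl v \<subseteq> verts (apex C)" if "v \<in> verts (apex C)" for v
  proof
    fix w assume "w \<in> ?cl v"
    then show "w \<in> verts (apex C)"
      using glue_class_lift[of r "\<lambda>w. w \<in> verts (apex C)" w v] that sub
      by (auto simp: r_def dest: set_zip_leftD set_zip_rightD)
  qed
  have "degree (glue (apex C) r) (?cl v) \<in>
      (if ?cl v \<in> set (map ?cl h) \<and> ?cl v \<in> set (map ?cl k) then {(0, 0)}
       else if ?cl v \<in> set (map ?cl h) then {(0, 1)}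
       else if ?cl v \<in> set (map ?cl k) then {(1, 0)}
       else {(0, 0), (1, 1)})" if v: "v \<in> verts (apex C)" for v
  proof (cases "?cl v \<subseteq> set f")
    case True
    then have "?cl v \<subseteq> set g" using cycle by simp
    \<comment> \<open>All vertices of a cycle lie in \<open>f\<close> and \<open>g\<close>, so
      \<open>v\<close> itself can serve as the distinguished vertex.\<close>
    have "in_degree (glue (apex C) r) (?cl v) = 0"
      using in_degree_glue[of r v v "apex C"] in0 True self by (auto simp: subset_iff)
    moreover have "out_degree (glue (apex C) r) (?cl v) = 0"
      using out_degree_glue[of r v v "apex C"] out0 \<open>?cl v \<subseteq> set g\<close> self by (auto simp: subset_iff)
    moreover have "?cl v \<inter> set h = {}" "?cl v \<inter> set k = {}"
      using True \<open>?cl v \<subseteq> set g\<close> dist by auto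
    ultimately show ?thesis
      unfolding mem_left mem_right by (simp add: degree_def)
  next
    case False
    then obtain s t where t: "t \<in> ?cl v" "t \<notin> set f" and s: "s \<in> ?cl v" "s \<notin> set g"
      using cycle by blast
    have others: "w \<in> set f" if "w \<in> ?cl v" "w \<noteq> t" for w
      using uniq_end that t by blast
    have others': "w \<in> set g" if "w \<in> ?cl v" "w \<noteq> s" for w
      using uniq_start that s by blast
    have "in_degree (glue (apex C) r) (?cl v) = in_degree (apex C) t"
      using in_degree_glue[of r v t "apex C"] in0 others t by simp
    moreover have "out_degree (glue (apex C) r) (?cl v) = out_degree (apex C) s"
      using out_degree_glue[of r v s "apex C"] out0 others' s by simp
    moreover have "?cl v \<inter> set h \<noteq> {} \<longleftrightarrow> t \<in> set h" "?cl v \<inter> set k \<noteq> {} \<longleftrightarrow> s \<in> set k"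
      using others others' t s dist by blast+
    moreover have "(in_degree (apex C) t, out_degree (apex C) s) \<in>
      (if t \<in> set h \<and> s \<in> set k then {(0, 0)}
       else if t \<in> set h then {(0, 1)}
       else if s \<in> set k then {(1, 0)}
       else {(0, 0), (1, 1)})"
    proof (cases "s = t")
      \<comment> \<open>The vertex lies in neither \<open>f\<close> nor \<open>g\<close>, so its
        interface membership is decided by \<open>h\<close> and \<open>k\<close> alone and its old
        condition is already the required one.\<close>
      case True
      then show ?thesis using deg[of t] verts_cl[OF v] t s by auto
    next
      case False
      \<comment> \<open>As \<open>s\<close> is in \<open>f\<close> but not in \<open>g\<close>, its
        out-degree is 0 if it is in \<open>k\<close> and 1 otherwise; dually \<open>t\<close> has
        in-degree 0 if it is in \<open>h\<close> and 1 otherwise. The two choices are independent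
        and yield exactly the four cases, with (1,1) when neither interface is met.\<close>
      then have "s \<in> set f" "t \<in> set g" using others others' s t by auto
      then show ?thesis
        using deg[of t] deg[of s] verts_cl[OF v] t s by (auto split: if_splits)
    qed
    ultimately show ?thesis
      unfolding mem_left mem_right degree_def by (simp only:)
  qed
  then have "\<forall>X\<in>verts (glue (apex C) r). degree (glue (apex C) r) X \<in>
      (if X \<in> set (map ?cl h) \<and> X \<in> set (map ?cl k) then {(0, 0)}
       else if X \<in> set (map ?cl h) then {(0, 1)}
       else if X \<in> set (map ?cl k) then {(1, 0)}
       else {(0, 0), (1, 1)})"
    unfolding verts_glue by blast
  then show ?thesis
    using left right unfolding partial_monogamous_def trace by (simp only: cospan.simps simp_thms)
qed

text \<open>Gluing never needs a larger universe: choosing a member of each class embeds the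
  quotient vertices back into \<open>'v\<close>, with the class map as left inverse, and the edges
  stay as they are.\<close>

lemma csp_class_trace_nonempty:
  fixes C :: "('v::infinite, 'e::infinite, 'g) cospan"
  assumes C: "cospan \<Sigma> (x + m) (x + n) C"
  shows "(csp_class \<Sigma> (trace_cospan x C) :: ('v, 'e, 'g) cospan set) \<noteq> {}"
proof -
  define r where "r = set (zip (take x (left_leg C)) (take x (right_leg C)))"
  have rep: "glue_class r (SOME w. w \<in> glue_class r v) = glue_class r v" for v
    by (rule sym, unfold glue_class_eq_iff_mem, rule someI[of _ v]) (simp add: glue_class_def)
  have "inj_on (\<lambda>X. SOME w. w \<in> X) (verts (glue (apex C) r))"
    by (rule inj_on_inverseI[where g = "glue_class r"]) (auto simp: rep)
  then show ?thesis
    by (intro csp_class_nonempty[OF cospan_trace[OF C], of "\<lambda>X. SOME w. w \<in> X" id])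
      (simp_all add: trace_cospan_def r_def Let_def)
qed

theorem theorem3p29:
  fixes \<Sigma> :: "'g signature" and x m n :: nat
    and T :: "('v::infinite, 'e::infinite, 'g) cospan set"
  assumes "T \<in> PM_Csp \<Sigma> (x + m) (x + n)"
  shows "canonical_trace \<Sigma> x m n T \<in> PM_Csp \<Sigma> m n"
proof -
  obtain C :: "('v, 'e, 'g) cospan" where T: "T = csp_class \<Sigma> C"
    and C: "cospan \<Sigma> (x + m) (x + n) C" and pm: "partial_monogamous C"
    using assms by (auto simp: PM_Csp_def)
  \<comment> \<open>\<open>PM_Csp\<close> asks for a representative in the universe types, whereas
    \<open>trace_cospan x C\<close> has vertices in \<open>'v set\<close>.\<close>
  obtain D :: "('v, 'e, 'g) cospan" where D: "D \<in> csp_class \<Sigma> (trace_cospan x C)"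
    using csp_class_trace_nonempty[OF C] by blast
  note D = csp_class_memD[OF cospan_trace[OF C] D]
  have "canonical_trace \<Sigma> x m n T = csp_class \<Sigma> D"
    unfolding T canonical_trace_class[OF C] by (rule csp_class_eqI[OF cospan_trace[OF C] D(2)])
  moreover have "partial_monogamous D"
    by (rule partial_monogamous_iso[OF cospan_trace[OF C] D(2) partial_monogamous_trace[OF C pm]])
  ultimately show ?thesis
    using D(1) by (auto simp: PM_Csp_def)
qed

end
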